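(* The space $H(\mathcal{SO})$ of all homomorphisms of the vector lattice $\mathcal{SO}$ of all slowly oscillating functions on the half-line $\mathbb{H}=[0,\infty)$ is homeomorphic to the space $(\mathbb{H}\times(0,\infty))\cup\{\mathbf{0}\}$, obtained by adding one point $\mathbf{0}$ to $\mathbb{H}\times(0,\infty)$, where $\mathbb{H}\times(0,\infty)$ is an open subspace carrying its usual product topology and a neighborhood base of the point $\mathbf{0}$ consists of the sets of the form $$\{(x,y)\in \mathbb{H}\times(0,\infty) : y\leq \varepsilon\cdot \eta_{\mathfrak{a}}(x)^{-1}\}\cup\{\mathbf{0}\}$$ for some $\varepsilon>0$ and the slowly oscillating function $\eta_{\mathfrak{a}}$ with respect to some strictly increasing sequence $\mathfrak{a}\subset\mathbb{N}$.
   Context: $\mathbb{H}=[0,\infty)$ carries the metric $|x-y|$, and $\mathbb{N}=\{1,2,3,\dots\}$. A continuous function $f:\mathbb{H}\to\mathbb{R}$ is slowly oscillating if for every $R>0$ and $\varepsilon>0$ there exists $M>0$ such that $\operatorname{diam} f([x,x+R])<\varepsilon$ for every $x>M$. $\mathcal{SO}$ denotes the set of all (possibly unbounded) real-valued slowly oscillating continuous functions on $\mathbb{H}$; it is a vector lattice under pointwise operations containing the constant function $\mathbf{1}$. A homomorphism $\phi:\mathcal{SO}\to\mathbb{R}$ is a linear map with $\phi(f\vee g)=\max(\phi(f),\phi(g))$ and $\phi(f\wedge g)=\min(\phi(f),\phi(g))$ for all $f,g\in\mathcal{SO}$ (the zero map is allowed). $H(\mathcal{SO})$ is the set of all homomorphisms,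 with the topology inherited from the product space $\mathbb{R}^{\mathcal{SO}}$ (the topology of pointwise convergence). A strictly increasing sequence $\mathfrak{a}=(a_n)_{n\ge 1}\subset\mathbb{N}$ is one with $a_n<a_{n+1}$ for all $n\in\mathbb{N}$. Given such $\mathfrak{a}$, put $\eta_{\mathfrak{a}}^{0}(x)=x+1$ for $x\in\mathbb{H}$, and for $n\geq 1$ define recursively $\eta_{\mathfrak{a}}^{n}(x)=\eta_{\mathfrak{a}}^{n-1}(x)$ for $0\leq x<a_n$ and $\eta_{\mathfrak{a}}^{n}(x)=\eta_{\mathfrak{a}}^{n-1}(a_n)+\frac1n(x-a_n)$ for $x\geq a_n$. The slowly oscillating function with respect to $\mathfrak{a}$ is $\eta_{\mathfrak{a}}:\mathbb{H}\to\mathbb{R}$, $\eta_{\mathfrak{a}}(x)=\lim_{n\to\infty}\eta_{\mathfrak{a}}^{n}(x)$ (the sequence is eventually constant at each $x$). It is a slowly oscillating continuous function with $\eta_{\mathfrak{a}}\geq 1$. *)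

theory Defs
  imports "HOL-Analysis.Analysis"
begin

text \<open>Functions on the half-line $[0,\infty)$ are represented by elements of
  \<^term>\<open>extensional {0..}\<close>, so that equality of representatives is equality on the half-line.\<close>

definition slowly_oscillating :: "(real \<Rightarrow> real) \<Rightarrow> bool" where
  "slowly_oscillating f \<longleftrightarrow>
     (\<forall>R>0. \<forall>\<epsilon>>0. \<exists>M>0. \<forall>x>M. diameter (f ` {x..x + R}) < \<epsilon>)"

definition SO :: "(real \<Rightarrow> real) set" where
  "SO = {f \<in> extensional {0..}. continuous_on {0..} f \<and> slowly_oscillating f}"

definition SO_add :: "(real \<Rightarrow> real) \<Rightarrow> (real \<Rightarrow> real) \<Rightarrow> real \<Rightarrow> real" where
  "SO_add f g = (\<lambda>x\<in>{0..}. f x + g x)"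

definition SO_scale :: "real \<Rightarrow> (real \<Rightarrow> real) \<Rightarrow> real \<Rightarrow> real" where
  "SO_scale c f = (\<lambda>x\<in>{0..}. c * f x)"

definition SO_sup :: "(real \<Rightarrow> real) \<Rightarrow> (real \<Rightarrow> real) \<Rightarrow> real \<Rightarrow> real" where
  "SO_sup f g = (\<lambda>x\<in>{0..}. max (f x) (g x))"

definition SO_inf :: "(real \<Rightarrow> real) \<Rightarrow> (real \<Rightarrow> real) \<Rightarrow> real \<Rightarrow> real" where
  "SO_inf f g = (\<lambda>x\<in>{0..}. min (f x) (g x))"

definition SO_homs :: "((real \<Rightarrow> real) \<Rightarrow> real) set" where
  "SO_homs = {\<phi> \<in> extensional SO.
     (\<forall>f\<in>SO. \<forall>g\<in>SO. \<phi> (SO_add f g) = \<phi> f + \<phi> g) \<and>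
     (\<forall>c. \<forall>f\<in>SO. \<phi> (SO_scale c f) = c * \<phi> f) \<and>
     (\<forall>f\<in>SO. \<forall>g\<in>SO. \<phi> (SO_sup f g) = max (\<phi> f) (\<phi> g)) \<and>
     (\<forall>f\<in>SO. \<forall>g\<in>SO. \<phi> (SO_inf f g) = min (\<phi> f) (\<phi> g))}"

definition H_SO :: "((real \<Rightarrow> real) \<Rightarrow> real) topology" where
  "H_SO = subtopology (product_topology (\<lambda>_. euclideanreal) SO) SO_homs"

text \<open>Sequences are indexed from 1; the value \<open>a 0\<close> is never used.\<close>

definition inc_seq :: "(nat \<Rightarrow> nat) \<Rightarrow> bool" where
  "inc_seq a \<longleftrightarrow> (\<forall>n\<ge>1. 1 \<le> a n \<and> a n < a (Suc n))"

primrec eta_approx :: "(nat \<Rightarrow> nat) \<Rightarrow> nat \<Rightarrow> real \<Rightarrow> real" where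
  "eta_approx a 0 = (\<lambda>x. x + 1)"
| "eta_approx a (Suc n) = (\<lambda>x.
     if x < real (a (Suc n)) then eta_approx a n x
     else eta_approx a n (real (a (Suc n))) + 1 / real (Suc n) * (x - real (a (Suc n))))"

definition eta :: "(nat \<Rightarrow> nat) \<Rightarrow> real \<Rightarrow> real" where
  "eta a x = lim (\<lambda>n. eta_approx a n x)"

lemma inc_seq_ge:
  assumes "inc_seq a" "n \<ge> 1"
  shows "n \<le> a n"
  using assms(2)
proof (induction n rule: dec_induct)
  case base
  then show ?case using assms(1) by (simp add: inc_seq_def)
next
  case (step n)
  then have "n \<le> a n" "a n < a (Suc n)" using assms(1) by (auto simp: inc_seq_def)
  then show ?case by simp
qed

lemma inc_seq_max:
  assumes "inc_seq a" "inc_seq b"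
  shows "inc_seq (\<lambda>n. max (a n) (b n))"
  unfolding inc_seq_def
proof (intro allI impI conjI)
  fix n :: nat assume "1 \<le> n"
  then have "1 \<le> a n" "a n < a (Suc n)" "b n < b (Suc n)"
    using assms by (auto simp: inc_seq_def)
  then show "1 \<le> max (a n) (b n)" "max (a n) (b n) < max (a (Suc n)) (b (Suc n))"
    by linarith+
qed

lemma eta_approx_last_piece:
  assumes "inc_seq a" "n \<ge> 1" "x \<ge> real (a n)"
  shows "eta_approx a n x = eta_approx a n (real (a n)) + (x - real (a n)) / real n"
  using assms by (cases n) auto

lemma eta_approx_Suc:
  assumes "inc_seq a" "n \<ge> 1"
  shows "eta_approx a (Suc n) x =
    eta_approx a n x - (1 / real n - 1 / real (Suc n)) * max 0 (x - real (a (Suc n)))"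
proof (cases "x < real (a (Suc n))")
  case True
  then show ?thesis by simp
next
  case False
  have "real (a n) < real (a (Suc n))" using assms by (simp add: inc_seq_def)
  then have "eta_approx a n x = eta_approx a n (real (a (Suc n))) + (x - real (a (Suc n))) / real n"
    using eta_approx_last_piece[OF assms, of x]
      eta_approx_last_piece[OF assms, of "real (a (Suc n))"] False
    by (simp add: diff_divide_distrib)
  then show ?thesis using False by (simp add: algebra_simps diff_divide_distrib)
qed

lemma eta_approx_1: "eta_approx a 1 x = x + 1"
  by simp

lemma eta_approx_continuous:
  assumes "inc_seq a"
  shows "continuous_on UNIV (eta_approx a n)"
proof (cases "n \<ge> 1")
  case True
  then show ?thesis
  proof (induction n rule: dec_induct)
    case base
    then show ?case by (subst eta_approx_1[abs_def]) (intro continuous_intros)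
  next
    case (step n)
    have "eta_approx a (Suc n) = (\<lambda>x. eta_approx a n x
        - (1 / real n - 1 / real (Suc n)) * max 0 (x - real (a (Suc n))))"
      using eta_approx_Suc[OF assms step.hyps(1)] by blast
    moreover have "continuous_on UNIV (\<lambda>x. eta_approx a n x
        - (1 / real n - 1 / real (Suc n)) * max 0 (x - real (a (Suc n))))"
      using step.IH by (intro continuous_intros) auto
    ultimately show ?case by metis
  qed
next
  case False
  then have "n = 0" by simp
  then show ?thesis by (simp add: continuous_intros)
qed

lemma eta_approx_antimono:
  assumes "inc_seq a" "inc_seq b" "\<And>n. a n \<le> b n"
  shows "eta_approx a n x \<le> eta_approx b n x"
proof (cases "n \<ge> 1")
  case True
  then show ?thesis
  proof (induction n rule: dec_induct)
    case base
    show ?case by (simp only: eta_approx_1)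
  next
    case (step n)
    have "(1 / real n - 1 / real (Suc n)) * max 0 (x - real (b (Suc n)))
        \<le> (1 / real n - 1 / real (Suc n)) * max 0 (x - real (a (Suc n)))"
      using assms(3)[of "Suc n"] step.hyps(1)
      by (intro mult_left_mono) (auto simp: field_simps)
    then show ?case
      using step.IH eta_approx_Suc[OF assms(1) step.hyps(1), of x]
        eta_approx_Suc[OF assms(2) step.hyps(1), of x] by linarith
  qed
next
  case False
  then have "n = 0" by simp
  then show ?thesis by simp
qed

lemma eta_approx_ge_1: "0 \<le> x \<Longrightarrow> 1 \<le> eta_approx a n x"
proof (induction n arbitrary: x)
  case (Suc n)
  show ?case
    using Suc.IH[OF Suc.prems] Suc.IH[of "real (a (Suc n))"]
    by (auto intro: add_increasing2)
qed simp

lemma eta_approx_stable: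
  assumes "inc_seq a" "x < real (Suc n)" "n \<le> m"
  shows "eta_approx a m x = eta_approx a n x"
  using assms(3)
proof (induction m rule: dec_induct)
  case (step m)
  have "Suc m \<le> a (Suc m)" using inc_seq_ge[OF assms(1)] by simp
  then have "x < real (a (Suc m))" using step.hyps assms(2) by linarith
  then show ?case using step.IH by simp
qed simp

lemma eta_eq:
  assumes "inc_seq a" "x < real (Suc n)"
  shows "eta a x = eta_approx a n x"
  unfolding eta_def
  by (rule limI, rule tendsto_eventually, rule eventually_sequentiallyI[of n])
    (rule eta_approx_stable[OF assms])

lemma eta_ge_1:
  assumes "inc_seq a" "0 \<le> x"
  shows "1 \<le> eta a x"
proof -
  obtain n where "x < real n" using reals_Archimedean2 by blast
  then have "x < real (Suc n)" by simp
  then show ?thesis using eta_eq[OF assms(1)] eta_approx_ge_1[OF assms(2)] by metis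
qed

lemma eta_antimono:
  assumes "inc_seq a" "inc_seq b" "\<And>n. a n \<le> b n"
  shows "eta a x \<le> eta b x"
proof -
  obtain n where "x < real n" using reals_Archimedean2 by blast
  then have "x < real (Suc n)" by simp
  then show ?thesis
    using eta_eq[OF assms(1)] eta_eq[OF assms(2)] eta_approx_antimono[OF assms] by metis
qed

lemma eta_continuous:
  assumes "inc_seq a"
  shows "continuous_on UNIV (eta a)"
proof -
  have "continuous_on {..<real (Suc n)} (eta a)" for n
    by (rule continuous_on_eq[OF continuous_on_subset[OF eta_approx_continuous[OF assms, of n]]])
      (auto simp: eta_eq[OF assms] simp del: of_nat_Suc)
  then have "continuous_on (\<Union>n. {..<real (Suc n)}) (eta a)"
    by (intro continuous_on_open_UN) auto
  moreover have "(\<Union>n. {..<real (Suc n)}) = (UNIV :: real set)"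
  proof -
    have "\<exists>n. x < real (Suc n)" for x
      by (meson lessI less_trans of_nat_less_iff reals_Archimedean2)
    then show ?thesis by auto
  qed
  ultimately show ?thesis by metis
qed

definition quarter_plane :: "(real \<times> real) set" where
  "quarter_plane = {0..} \<times> {0<..}"

text \<open>The added point is \<^const>\<open>None\<close>; a point \<open>p\<close> of the product is \<open>Some p\<close>.\<close>

definition model_carrier :: "(real \<times> real) option set" where
  "model_carrier = insert None (Some ` quarter_plane)"

definition zero_nhd :: "real \<Rightarrow> (nat \<Rightarrow> nat) \<Rightarrow> (real \<times> real) option set" where
  "zero_nhd \<epsilon> a =
     insert None (Some ` {(x, y). (x, y) \<in> quarter_plane \<and> y \<le> \<epsilon> * inverse (eta a x)})"

definition model_open :: "(real \<times> real) option set \<Rightarrow> bool" where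
  "model_open U \<longleftrightarrow> U \<subseteq> model_carrier \<and>
     openin (top_of_set quarter_plane) (Some -` U) \<and>
     (None \<in> U \<longrightarrow> (\<exists>\<epsilon>>0. \<exists>a. inc_seq a \<and> zero_nhd \<epsilon> a \<subseteq> U))"

definition model_space :: "(real \<times> real) option topology" where
  "model_space = topology model_open"

lemma zero_nhd_Int:
  assumes "inc_seq a" "inc_seq b"
  shows "zero_nhd (min \<epsilon> \<delta>) (\<lambda>n. max (a n) (b n)) \<subseteq> zero_nhd \<epsilon> a \<inter> zero_nhd \<delta> b"
proof -
  define c where "c = (\<lambda>n. max (a n) (b n))"
  have c: "inc_seq c" unfolding c_def by (rule inc_seq_max[OF assms])
  have *: "y \<le> \<gamma> * inverse (eta d x)"
    if "0 \<le> x" "0 < y" "y \<le> min \<epsilon> \<delta> * inverse (eta c x)" "min \<epsilon> \<delta> \<le> \<gamma>" "inc_seq d"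
      "\<And>n. d n \<le> c n" for x y \<gamma> d
  proof -
    have e: "1 \<le> eta d x" "eta d x \<le> eta c x"
      using eta_ge_1 eta_antimono c that by auto
    have "0 < min \<epsilon> \<delta> * inverse (eta c x)" using that by linarith
    then have "0 < min \<epsilon> \<delta>" using e by (simp add: zero_less_mult_iff)
    then have "min \<epsilon> \<delta> * inverse (eta c x) \<le> \<gamma> * inverse (eta d x)"
      using e that(4) by (intro mult_mono) (auto intro: le_imp_inverse_le)
    then show ?thesis using that(3) by linarith
  qed
  have "a n \<le> c n" "b n \<le> c n" for n by (auto simp: c_def)
  then show ?thesis
    unfolding c_def[symmetric]
    using *[of _ _ \<epsilon> a] *[of _ _ \<delta> b] assms
    by (auto simp: zero_nhd_def quarter_plane_def)
qed

lemma istopology_model_open: "istopology model_open"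
  unfolding istopology_def
proof (intro conjI allI impI)
  fix S T assume S: "model_open S" and T: "model_open T"
  have "\<exists>\<epsilon>>0. \<exists>a. inc_seq a \<and> zero_nhd \<epsilon> a \<subseteq> S \<inter> T" if N: "None \<in> S \<inter> T"
  proof -
    obtain \<epsilon> a where 1: "\<epsilon> > 0" "inc_seq a" "zero_nhd \<epsilon> a \<subseteq> S"
      using N S unfolding model_open_def by blast
    obtain \<delta> b where 2: "\<delta> > 0" "inc_seq b" "zero_nhd \<delta> b \<subseteq> T"
      using N T unfolding model_open_def by blast
    have "zero_nhd (min \<epsilon> \<delta>) (\<lambda>n. max (a n) (b n)) \<subseteq> S \<inter> T"
      using zero_nhd_Int[OF 1(2) 2(2), of \<epsilon> \<delta>] 1(3) 2(3) by blast
    moreover have "min \<epsilon> \<delta> > 0" using 1 2 by simp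
    ultimately show ?thesis using inc_seq_max[OF 1(2) 2(2)] by blast
  qed
  with S T show "model_open (S \<inter> T)"
    unfolding model_open_def vimage_Int by (auto intro: openin_Int)
next
  fix \<K> assume K: "\<forall>K\<in>\<K>. model_open K"
  have "openin (top_of_set quarter_plane) (\<Union>K\<in>\<K>. Some -` K)"
    using K by (intro openin_Union) (auto simp: model_open_def)
  moreover have "\<exists>\<epsilon>>0. \<exists>a. inc_seq a \<and> zero_nhd \<epsilon> a \<subseteq> \<Union>\<K>" if N: "None \<in> \<Union>\<K>"
  proof -
    obtain K where "K \<in> \<K>" "None \<in> K" using N by blast
    with K show ?thesis unfolding model_open_def by (meson Union_upper order_trans)
  qed
  ultimately show "model_open (\<Union>\<K>)"
    using K unfolding model_open_def vimage_Union by blast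
qed

lemma openin_model_space: "openin model_space U \<longleftrightarrow> model_open U"
  by (simp add: model_space_def topology_inverse'[OF istopology_model_open])

text \<open>The following three facts state that \<^const>\<open>model_space\<close> has the intended topology.\<close>

lemma topspace_model_space: "topspace model_space = model_carrier"
proof -
  have "zero_nhd 1 (\<lambda>n. n) \<subseteq> model_carrier" "inc_seq (\<lambda>n. n)"
    by (auto simp: zero_nhd_def model_carrier_def inc_seq_def)
  moreover have "Some -` model_carrier = quarter_plane"
    by (auto simp: model_carrier_def)
  ultimately have "openin model_space model_carrier"
    unfolding openin_model_space model_open_def using zero_less_one by (metis order_refl openin_subtopology_self)
  moreover have "U \<subseteq> model_carrier" if "openin model_space U" for U
    using that by (simp add: openin_model_space model_open_def)
  ultimately show ?thesis by (meson openin_subset openin_topspace subset_antisym)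
qed

lemma openin_model_space_Some:
  "openin model_space (Some ` V) \<longleftrightarrow> openin (top_of_set quarter_plane) V"
proof -
  have "Some -` (Some ` V) = V" by auto
  moreover have "V \<subseteq> quarter_plane" if "openin (top_of_set quarter_plane) V"
    using openin_imp_subset[OF that] .
  ultimately show ?thesis
    by (auto simp: openin_model_space model_open_def model_carrier_def)
qed

lemma nhd_base_zero_model_space:
  "(\<exists>U. openin model_space U \<and> None \<in> U \<and> U \<subseteq> N) \<longleftrightarrow>
   (\<exists>\<epsilon>>0. \<exists>a. inc_seq a \<and> zero_nhd \<epsilon> a \<subseteq> N)"
proof
  assume "\<exists>U. openin model_space U \<and> None \<in> U \<and> U \<subseteq> N"
  then show "\<exists>\<epsilon>>0. \<exists>a. inc_seq a \<and> zero_nhd \<epsilon> a \<subseteq> N"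
    unfolding openin_model_space model_open_def by (meson order_trans)
next
  assume "\<exists>\<epsilon>>0. \<exists>a. inc_seq a \<and> zero_nhd \<epsilon> a \<subseteq> N"
  then obtain \<epsilon> a where a: "\<epsilon> > 0" "inc_seq a" "zero_nhd \<epsilon> a \<subseteq> N" by blast
  define V where "V = {p \<in> quarter_plane. snd p * eta a (fst p) < \<epsilon>}"
  have V: "y < \<epsilon> * inverse (eta a x)" if "(x, y) \<in> V" for x y
    using that eta_ge_1[OF a(2), of x] by (auto simp: V_def quarter_plane_def field_simps)
  have cont: "continuous_on UNIV (\<lambda>p :: real \<times> real. snd p * eta a (fst p))"
    by (intro continuous_intros continuous_on_compose2[OF eta_continuous[OF a(2)]]) auto
  have "open {p :: real \<times> real. snd p * eta a (fst p) < \<epsilon>}"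
    by (intro open_Collect_less cont continuous_on_const)
  moreover have "V = quarter_plane \<inter> {p. snd p * eta a (fst p) < \<epsilon>}" by (auto simp: V_def)
  ultimately have openV: "openin (top_of_set quarter_plane) V" by blast
  let ?U = "insert None (Some ` V)"
  have U: "?U \<subseteq> zero_nhd \<epsilon> a"
    using V by (fastforce simp: zero_nhd_def V_def)
  have "zero_nhd (\<epsilon> / 2) a \<subseteq> ?U"
  proof -
    have "(x, y) \<in> V" if "(x, y) \<in> quarter_plane" "y \<le> \<epsilon> / 2 * inverse (eta a x)" for x y
    proof -
      have e: "1 \<le> eta a x" using that eta_ge_1[OF a(2)] by (auto simp: quarter_plane_def)
      then have "y * eta a x \<le> \<epsilon> / 2 * inverse (eta a x) * eta a x"
        using that by (intro mult_right_mono) auto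
      also have "\<dots> = \<epsilon> / 2" using e by simp
      also have "\<dots> < \<epsilon>" using a(1) by simp
      finally show ?thesis using that by (simp add: V_def)
    qed
    then show ?thesis by (auto simp: zero_nhd_def)
  qed
  moreover have "Some -` ?U = V" by auto
  moreover have "?U \<subseteq> model_carrier" by (auto simp: model_carrier_def V_def)
  moreover have "\<epsilon> / 2 > 0" using a by simp
  ultimately have "openin model_space ?U"
    unfolding openin_model_space model_open_def using openV a(2) by metis
  then show "\<exists>U. openin model_space U \<and> None \<in> U \<and> U \<subseteq> N"
    using U a(3) by (intro exI[of _ ?U]) auto
qed

end

theory Submission
  imports Defs
begin

text \<open>Every slowly oscillating function is dominated by a multiple of some \<^term>\<open>eta a\<close>, and even
  all its multiples are, up to additive constants. Hence a nonzero homomorphism \<open>\<phi>\<close> is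
  positive on some function that is \<open>\<le> 0\<close> outside a compact interval, and a compactness
  argument yields a point \<open>x\<close> of that interval at which the kernel of \<open>\<phi>\<close> vanishes; so \<open>\<phi>\<close>
  is \<open>\<phi>(1)\<close> times evaluation at \<open>x\<close>. Sending \<open>(x, y)\<close> to \<open>y\<close> times evaluation at \<open>x\<close> is
  then the homeomorphism: domination by \<open>eta a\<close> gives continuity at the added point, testing on
  \<open>eta a\<close> itself gives openness there, and tent functions give openness elsewhere.\<close>

section \<open>Slow oscillation and closure of \<open>SO\<close> under the lattice
  operations\<close>

text \<open>Pairwise differences are easier to estimate than \<open>diameter\<close>, which bounds
  distances only on bounded sets; continuity makes \<open>f\<close> bounded on each compact window.
  Passing between \<open><\<close> and \<open>\<le>\<close> costs a halving of
  \<open>\<epsilon>\<close>.\<close>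

lemma slowly_oscillating_iff:
  assumes "continuous_on {0..} f"
  shows "slowly_oscillating f \<longleftrightarrow>
    (\<forall>R>0. \<forall>\<epsilon>>0. \<exists>M. \<forall>x>M. \<forall>u\<in>{x..x + R}. \<forall>v\<in>{x..x + R}. \<bar>f u - f v\<bar> \<le> \<epsilon>)"
    (is "_ \<longleftrightarrow> ?osc")
proof
  assume s: "slowly_oscillating f"
  show ?osc
  proof (intro allI impI)
    fix R \<epsilon> :: real assume "R > 0" "\<epsilon> > 0"
    with s obtain M where M: "M > 0" "\<And>x. x > M \<Longrightarrow> diameter (f ` {x..x + R}) < \<epsilon>"
      unfolding slowly_oscillating_def by metis
    have "\<bar>f u - f v\<bar> \<le> \<epsilon>" if "x > M" "u \<in> {x..x + R}" "v \<in> {x..x + R}" for x u v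
    proof -
      have "continuous_on {x..x + R} f"
        using assms by (rule continuous_on_subset) (use that M in auto)
      then have "bounded (f ` {x..x + R})"
        by (intro compact_imp_bounded compact_continuous_image) auto
      then have "dist (f u) (f v) \<le> diameter (f ` {x..x + R})"
        using that by (intro diameter_bounded_bound) auto
      then show ?thesis using M(2)[OF that(1)] by (simp add: dist_real_def)
    qed
    then show "\<exists>M. \<forall>x>M. \<forall>u\<in>{x..x + R}. \<forall>v\<in>{x..x + R}. \<bar>f u - f v\<bar> \<le> \<epsilon>" by blast
  qed
next
  assume o: ?osc
  show "slowly_oscillating f"
    unfolding slowly_oscillating_def
  proof (intro allI impI)
    fix R \<epsilon> :: real assume "R > 0" "\<epsilon> > 0"
    with o obtain M where M:
      "\<And>x u v. \<lbrakk>x > M; u \<in> {x..x + R}; v \<in> {x..x + R}\<rbrakk> \<Longrightarrow> \<bar>f u - f v\<bar> \<le> \<epsilon> / 2"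
      by (meson half_gt_zero)
    have "diameter (f ` {x..x + R}) < \<epsilon>" if "x > max M 1" for x
    proof -
      have "diameter (f ` {x..x + R}) \<le> \<epsilon> / 2"
        using M[of x] that \<open>\<epsilon> > 0\<close> by (intro diameter_le) auto
      then show ?thesis using \<open>\<epsilon> > 0\<close> by linarith
    qed
    then show "\<exists>M>0. \<forall>x>M. diameter (f ` {x..x + R}) < \<epsilon>"
      by (intro exI[of _ "max M 1"]) auto
  qed
qed

text \<open>Lets estimates be made for an unrestricted \<open>f\<close>: beyond
  \<open>max M 0\<close> all windows lie in the half-line, where \<open>f\<close> and its
  restriction agree.\<close>

lemma SO_I:
  assumes "continuous_on {0..} f"
    and "\<And>R \<epsilon>. R > 0 \<Longrightarrow> \<epsilon> > 0 \<Longrightarrow>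
      \<exists>M. \<forall>x>M. \<forall>u\<in>{x..x + R}. \<forall>v\<in>{x..x + R}. \<bar>f u - f v\<bar> \<le> \<epsilon>"
  shows "restrict f {0..} \<in> SO"
proof -
  let ?g = "restrict f {0..}"
  have c: "continuous_on {0..} ?g"
    using assms(1) by (rule continuous_on_eq) auto
  have "\<exists>M. \<forall>x>M. \<forall>u\<in>{x..x + R}. \<forall>v\<in>{x..x + R}. \<bar>?g u - ?g v\<bar> \<le> \<epsilon>"
    if R: "R > 0" "\<epsilon> > 0" for R \<epsilon>
  proof -
    obtain M where "\<forall>x>M. \<forall>u\<in>{x..x + R}. \<forall>v\<in>{x..x + R}. \<bar>f u - f v\<bar> \<le> \<epsilon>"
      using assms(2)[OF R] by blast
    then show ?thesis by (intro exI[of _ "max M 0"]) auto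
  qed
  then show ?thesis
    using c by (auto simp: SO_def slowly_oscillating_iff)
qed

lemma SO_continuous: "f \<in> SO \<Longrightarrow> continuous_on {0..} f"
  by (simp add: SO_def)

lemma SO_osc:
  assumes "f \<in> SO" "R > 0" "\<epsilon> > 0"
  shows "\<exists>M. \<forall>x>M. \<forall>u\<in>{x..x + R}. \<forall>v\<in>{x..x + R}. \<bar>f u - f v\<bar> \<le> \<epsilon>"
  using assms by (auto simp: SO_def slowly_oscillating_iff)

text \<open>Sums, maxima and minima all change by at most the sum of the changes of their two
  arguments, so one criterion serves all three.\<close>

lemma SO_combine:
  assumes f: "f \<in> SO" and g: "g \<in> SO" and "continuous_on {0..} h"
    and le: "\<And>u v. \<bar>h u - h v\<bar> \<le> \<bar>f u - f v\<bar> + \<bar>g u - g v\<bar>"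
  shows "restrict h {0..} \<in> SO"
proof (rule SO_I[OF assms(3)])
  fix R \<epsilon> :: real assume R: "R > 0" and "\<epsilon> > 0"
  then have "\<epsilon> / 2 > 0" by simp
  obtain M where M: "\<forall>x>M. \<forall>u\<in>{x..x + R}. \<forall>v\<in>{x..x + R}. \<bar>f u - f v\<bar> \<le> \<epsilon> / 2"
    using SO_osc[OF f R \<open>\<epsilon> / 2 > 0\<close>] by blast
  obtain N where N: "\<forall>x>N. \<forall>u\<in>{x..x + R}. \<forall>v\<in>{x..x + R}. \<bar>g u - g v\<bar> \<le> \<epsilon> / 2"
    using SO_osc[OF g R \<open>\<epsilon> / 2 > 0\<close>] by blast
  have "\<bar>h u - h v\<bar> \<le> \<epsilon>" if "x > max M N" "u \<in> {x..x + R}" "v \<in> {x..x + R}" for x u v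
  proof -
    have "\<bar>f u - f v\<bar> \<le> \<epsilon> / 2" "\<bar>g u - g v\<bar> \<le> \<epsilon> / 2" using M N that by auto
    then show ?thesis using le[of u v] by linarith
  qed
  then show "\<exists>M. \<forall>x>M. \<forall>u\<in>{x..x + R}. \<forall>v\<in>{x..x + R}. \<bar>h u - h v\<bar> \<le> \<epsilon>" by blast
qed

lemma SO_add_closed:
  assumes "f \<in> SO" "g \<in> SO"
  shows "SO_add f g \<in> SO"
  unfolding SO_add_def
  by (rule SO_combine[OF assms])
    (intro continuous_intros SO_continuous[OF assms(1)] SO_continuous[OF assms(2)], auto)

lemma SO_sup_closed:
  assumes "f \<in> SO" "g \<in> SO"
  shows "SO_sup f g \<in> SO"
  unfolding SO_sup_def
  by (rule SO_combine[OF assms])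
    (intro continuous_intros SO_continuous[OF assms(1)] SO_continuous[OF assms(2)], auto)

lemma SO_inf_closed:
  assumes "f \<in> SO" "g \<in> SO"
  shows "SO_inf f g \<in> SO"
  unfolding SO_inf_def
  by (rule SO_combine[OF assms])
    (intro continuous_intros SO_continuous[OF assms(1)] SO_continuous[OF assms(2)], auto)

lemma SO_scale_closed:
  assumes f: "f \<in> SO"
  shows "SO_scale c f \<in> SO"
  unfolding SO_scale_def
proof (rule SO_I)
  show "continuous_on {0..} (\<lambda>x. c * f x)"
    by (intro continuous_intros SO_continuous f)
  fix R \<epsilon> :: real assume R: "R > 0" and \<epsilon>: "\<epsilon> > 0"
  \<comment> \<open>Adding 1 to \<open>\<bar>c\<bar>\<close> keeps the divisor positive when
    \<open>c = 0\<close>.\<close>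
  then have pos: "\<epsilon> / (\<bar>c\<bar> + 1) > 0" by (simp add: add_nonneg_pos)
  obtain M where M: "\<forall>x>M. \<forall>u\<in>{x..x + R}. \<forall>v\<in>{x..x + R}. \<bar>f u - f v\<bar> \<le> \<epsilon> / (\<bar>c\<bar> + 1)"
    using SO_osc[OF f R pos] by blast
  have "\<bar>c * f u - c * f v\<bar> \<le> \<epsilon>" if "x > M" "u \<in> {x..x + R}" "v \<in> {x..x + R}" for x u v
  proof -
    have "\<bar>f u - f v\<bar> \<le> \<epsilon> / (\<bar>c\<bar> + 1)" using M that by blast
    then have "(\<bar>c\<bar> + 1) * \<bar>f u - f v\<bar> \<le> \<epsilon>" by (simp add: field_simps)
    moreover have "\<bar>c * f u - c * f v\<bar> \<le> (\<bar>c\<bar> + 1) * \<bar>f u - f v\<bar>"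
      unfolding right_diff_distrib[symmetric] abs_mult by (intro mult_right_mono) auto
    ultimately show ?thesis by linarith
  qed
  then show "\<exists>M. \<forall>x>M. \<forall>u\<in>{x..x + R}. \<forall>v\<in>{x..x + R}. \<bar>c * f u - c * f v\<bar> \<le> \<epsilon>" by blast
qed

lemma SO_eventually_const:
  assumes "continuous_on {0..} f" "\<And>x. x \<ge> B \<Longrightarrow> f x = c"
  shows "restrict f {0..} \<in> SO"
proof (rule SO_I[OF assms(1)])
  fix R \<epsilon> :: real assume "\<epsilon> > 0"
  then show "\<exists>M. \<forall>x>M. \<forall>u\<in>{x..x + R}. \<forall>v\<in>{x..x + R}. \<bar>f u - f v\<bar> \<le> \<epsilon>"
    using assms(2) by (intro exI[of _ B]) auto
qed

section \<open>Particular members of \<open>SO\<close>\<close>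

definition SO_one :: "real \<Rightarrow> real" where
  "SO_one = (\<lambda>x\<in>{0..}. 1)"

text \<open>Serves twice: being unbounded it absorbs additive constants, and being strictly
  increasing it separates the points of the half-line.\<close>

definition SO_ln :: "real \<Rightarrow> real" where
  "SO_ln = (\<lambda>x\<in>{0..}. ln (1 + x))"

text \<open>For \<open>r > 0\<close> this is positive exactly at distance less than \<open>r\<close>
  from \<open>c\<close>, so a positive value locates the first coordinate.\<close>

definition SO_tent :: "real \<Rightarrow> real \<Rightarrow> real \<Rightarrow> real" where
  "SO_tent c r = (\<lambda>x\<in>{0..}. max 0 (r - \<bar>x - c\<bar>))"

definition SO_eta :: "(nat \<Rightarrow> nat) \<Rightarrow> real \<Rightarrow> real" where
  "SO_eta a = restrict (eta a) {0..}"

lemma SO_one_closed: "SO_one \<in> SO"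
  unfolding SO_one_def by (rule SO_eventually_const) auto

lemma SO_tent_closed: "SO_tent c r \<in> SO"
  unfolding SO_tent_def
  by (rule SO_eventually_const[of _ "c + \<bar>r\<bar>" 0]) (auto intro!: continuous_intros)

text \<open>By \<open>ln (1 + s) \<le> s\<close> with \<open>s = (v - u) / (1 + u)\<close>, the
  increment over a window of length \<open>R\<close> starting at \<open>x\<close> is at most
  \<open>R / x\<close>.\<close>

lemma SO_ln_closed: "SO_ln \<in> SO"
  unfolding SO_ln_def
proof (rule SO_I)
  show "continuous_on {0..} (\<lambda>x. ln (1 + x) :: real)"
    by (intro continuous_intros) auto
  fix R \<epsilon> :: real assume R: "R > 0" and \<epsilon>: "\<epsilon> > 0"
  have *: "ln (1 + v) - ln (1 + u) \<le> \<epsilon>"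
    if "x > max 0 (R / \<epsilon>)" "x \<le> u" "v \<le> x + R" "u \<le> v" for x u v
  proof -
    have "1 + u > 0" "1 + v > 0" using that by auto
    then have "ln (1 + v) - ln (1 + u) = ln ((1 + v) / (1 + u))" by (simp add: ln_div)
    also have "(1 + v) / (1 + u) = 1 + (v - u) / (1 + u)" using \<open>1 + u > 0\<close> by (simp add: field_simps)
    also have "ln \<dots> \<le> (v - u) / (1 + u)"
      using that by (intro ln_add_one_self_le_self) auto
    also have "\<dots> \<le> R / x" using that by (intro frac_le) auto
    also have "R / x \<le> \<epsilon>"
    proof -
      have "0 < x" "R / \<epsilon> < x" using that by auto
      then show ?thesis using \<epsilon> by (simp add: field_simps)
    qed
    finally show ?thesis .
  qed
  have "\<bar>ln (1 + u) - ln (1 + v)\<bar> \<le> \<epsilon>"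
    if x: "x > max 0 (R / \<epsilon>)" and uv: "u \<in> {x..x + R}" "v \<in> {x..x + R}" for x u v
  proof (cases "u \<le> v")
    case True
    then have "ln (1 + u) \<le> ln (1 + v)" using x uv by simp
    then show ?thesis using *[OF x, of u v] True uv by simp
  next
    case False
    then have "ln (1 + v) \<le> ln (1 + u)" using x uv by simp
    then show ?thesis using *[OF x, of v u] False uv by simp
  qed
  then show "\<exists>M. \<forall>x>M. \<forall>u\<in>{x..x + R}. \<forall>v\<in>{x..x + R}. \<bar>ln (1 + u) - ln (1 + v)\<bar> \<le> \<epsilon>"
    by blast
qed

section \<open>Monotonicity and slopes of \<open>eta a\<close>\<close>

lemma eta_approx_mono: "x \<le> y \<Longrightarrow> eta_approx a n x \<le> eta_approx a n y"
proof (induction n arbitrary: x y)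
  case (Suc n)
  let ?b = "real (a (Suc n))"
  consider "y < ?b" | "x < ?b" "?b \<le> y" | "?b \<le> x" using Suc.prems by linarith
  then show ?case
  proof cases
    case 2
    have "eta_approx a n x \<le> eta_approx a n ?b" using Suc.IH 2 by simp
    then show ?thesis using 2 by (auto intro: add_increasing2)
  qed (use Suc in \<open>auto intro: divide_right_mono\<close>)
qed simp

text \<open>The last piece of stage \<open>n\<close> has slope exactly \<open>1/n\<close>, and by
  \<open>eta_approx_Suc\<close> each later stage subtracts a nondecreasing function, so increments
  can only shrink.\<close>

lemma eta_approx_lipschitz:
  assumes "inc_seq a" "1 \<le> n" "n \<le> m" "real (a n) \<le> x" "x \<le> y"
  shows "eta_approx a m y - eta_approx a m x \<le> (y - x) / real n"
  using assms(3)
proof (induction m rule: dec_induct)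
  case base
  have "real (a n) \<le> y" using assms by linarith
  from eta_approx_last_piece[OF assms(1,2) this] eta_approx_last_piece[OF assms(1,2,4)]
  show ?case by (simp add: diff_divide_distrib)
next
  case (step m)
  have m: "1 \<le> m" using step assms by simp
  have "(1 / real m - 1 / real (Suc m)) * max 0 (x - real (a (Suc m)))
      \<le> (1 / real m - 1 / real (Suc m)) * max 0 (y - real (a (Suc m)))"
    using m assms by (intro mult_left_mono) (auto simp: field_simps)
  then show ?case
    using step.IH eta_approx_Suc[OF assms(1) m, of x] eta_approx_Suc[OF assms(1) m, of y]
    by linarith
qed

text \<open>A common stage at which both points have reached their limit values, so that two-point
  inequalities pass from \<open>eta_approx\<close> to \<open>eta\<close>.\<close>

lemma eta_eq_max:
  assumes "inc_seq a"
  obtains m where "n \<le> m" "eta a x = eta_approx a m x" "eta a y = eta_approx a m y"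
proof -
  obtain k where k: "max x y < real k" using reals_Archimedean2 by blast
  have "x < real (Suc (max n k))" "y < real (Suc (max n k))" using k by auto
  then show thesis using that[of "max n k"] eta_eq[OF assms] by auto
qed

lemma eta_mono:
  assumes "inc_seq a" "x \<le> y"
  shows "eta a x \<le> eta a y"
  by (rule eta_eq_max[OF assms(1), of 0 x y]) (simp add: eta_approx_mono[OF assms(2)])

lemma eta_lipschitz:
  assumes "inc_seq a" "1 \<le> n" "real (a n) \<le> x" "x \<le> y"
  shows "eta a y - eta a x \<le> (y - x) / real n"
  by (rule eta_eq_max[OF assms(1), of n x y]) (simp add: eta_approx_lipschitz[OF assms(1,2) _ assms(3,4)])

text \<open>Later stages alter values only to the right of breakpoints that are at least
  \<open>a (Suc n)\<close>.\<close>

lemma eta_eq_below: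
  assumes a: "inc_seq a" and x: "x \<le> real (a (Suc n))"
  shows "eta a x = eta_approx a n x"
proof -
  have eq: "eta_approx a m x = eta_approx a n x" if "n \<le> m" for m
    using that
  proof (induction m rule: dec_induct)
    case (step m)
    have "a (Suc n) \<le> a (Suc m)" using step.hyps(1)
    proof (induction m rule: dec_induct)
      case (step k)
      have "a (Suc k) < a (Suc (Suc k))" using a by (simp add: inc_seq_def)
      then show ?case using step.IH by linarith
    qed simp
    then have "x \<le> real (a (Suc m))" using x by linarith
    \<comment> \<open>If \<open>x\<close> equals the breakpoint, the second branch of the recursion
      applies, but its linear term vanishes there.\<close>
    then show ?case using step.IH by auto
  qed simp
  obtain m where m: "n \<le> m" "eta a x = eta_approx a m x"
    using eta_eq_max[OF a, of n x x] by blast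
  show ?thesis using m(2) eq[OF m(1)] by (rule trans)
qed

text \<open>Domination needs growth of \<open>eta a\<close> from below, whereas
  \<open>eta_lipschitz\<close> bounds it only from above; between consecutive breakpoints the slope
  is exact.\<close>

lemma eta_increment:
  assumes a: "inc_seq a" and n: "1 \<le> n" and x: "real (a n) \<le> x" "x \<le> y" "y \<le> real (a (Suc n))"
  shows "eta a y - eta a x = (y - x) / real n"
proof -
  have "x \<le> real (a (Suc n))" "real (a n) \<le> y" using x by linarith+
  then show ?thesis
    using eta_eq_below[OF a, of x n] eta_eq_below[OF a x(3)]
      eta_approx_last_piece[OF a n x(1)] eta_approx_last_piece[OF a n, of y]
    by (simp add: diff_divide_distrib)
qed

text \<open>Beyond \<open>a n\<close> slopes are at most \<open>1/n\<close>, so a window of length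
  \<open>R\<close> contributes at most \<open>R/n\<close>, which is below \<open>\<epsilon>\<close>
  once \<open>n > R / \<epsilon>\<close>.\<close>

lemma SO_eta_closed:
  assumes a: "inc_seq a"
  shows "SO_eta a \<in> SO"
  unfolding SO_eta_def
proof (rule SO_I)
  show "continuous_on {0..} (eta a)"
    using eta_continuous[OF a] by (rule continuous_on_subset) auto
  fix R \<epsilon> :: real assume R: "R > 0" and \<epsilon>: "\<epsilon> > 0"
  obtain n where n: "R / \<epsilon> < real n" using reals_Archimedean2 by blast
  have "0 < R / \<epsilon>" using R \<epsilon> by simp
  then have n0: "0 < real n" using n by linarith
  have *: "eta a v - eta a u \<le> \<epsilon>"
    if "x > real (a n)" "x \<le> u" "v \<le> x + R" "u \<le> v" for x u v
  proof -
    have "eta a v - eta a u \<le> (v - u) / real n"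
      using n0 that by (intro eta_lipschitz[OF a]) auto
    also have "\<dots> \<le> R / real n" using that by (intro divide_right_mono) auto
    also have "\<dots> \<le> \<epsilon>" using n n0 \<epsilon> by (simp add: field_simps)
    finally show ?thesis .
  qed
  have "\<bar>eta a u - eta a v\<bar> \<le> \<epsilon>"
    if x: "x > real (a n)" and uv: "u \<in> {x..x + R}" "v \<in> {x..x + R}" for x u v
    using *[OF x, of u v] *[OF x, of v u] uv eta_mono[OF a, of u v] eta_mono[OF a, of v u]
    by (cases "u \<le> v") auto
  then show "\<exists>M. \<forall>x>M. \<forall>u\<in>{x..x + R}. \<forall>v\<in>{x..x + R}. \<bar>eta a u - eta a v\<bar> \<le> \<epsilon>"
    by blast
qed

section \<open>Domination by \<open>eta a\<close>\<close>

lemma SO_bounded_initial: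
  assumes "f \<in> SO"
  obtains K where "0 \<le> K" "\<And>x. x \<in> {0..B} \<Longrightarrow> \<bar>f x\<bar> \<le> K"
proof -
  have "continuous_on {0..B} f"
    using SO_continuous[OF assms] by (rule continuous_on_subset) auto
  then have "bounded (f ` {0..B})"
    by (intro compact_imp_bounded compact_continuous_image) auto
  then obtain K where "0 < K" "\<forall>y\<in>f ` {0..B}. norm y \<le> K"
    by (auto simp: bounded_pos)
  then show thesis by (intro that[of K]) auto
qed

text \<open>Beyond \<open>a n\<close> the function \<open>eta a\<close> grows by \<open>1/n\<close> per unit step; \<open>a\<close> is chosen so
  sparse that there \<open>f\<close> grows by at most \<open>1/n\<^sup>2\<close>, so \<open>t * \<bar>f\<bar>\<close> grows more slowly than
  \<open>eta a\<close> as soon as \<open>n \<ge> t\<close>.\<close>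

lemma SO_dominated_by_eta:
  assumes f: "f \<in> SO"
  obtains a where "inc_seq a" "\<And>t. 0 \<le> t \<Longrightarrow> \<exists>K. \<forall>x\<ge>0. t * \<bar>f x\<bar> \<le> K + eta a x"
proof -
  have "\<exists>N::nat. \<forall>x\<ge>real N. \<forall>u\<in>{x..x + 1}. \<forall>v\<in>{x..x + 1}. \<bar>f u - f v\<bar> \<le> 1 / (real (Suc n))\<^sup>2" for n
  proof -
    have "1 / (real (Suc n))\<^sup>2 > 0" by simp
    from SO_osc[OF f zero_less_one this] obtain M
      where M: "\<forall>x>M. \<forall>u\<in>{x..x + 1}. \<forall>v\<in>{x..x + 1}. \<bar>f u - f v\<bar> \<le> 1 / (real (Suc n))\<^sup>2" by blast
    obtain N where "M < real N" using reals_Archimedean2 by blast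
    then have "\<forall>x\<ge>real N. M < x" by auto
    then show ?thesis using M by blast
  qed
  then obtain N :: "nat \<Rightarrow> nat" where N:
    "\<And>n x u v. \<lbrakk>real (N n) \<le> x; u \<in> {x..x + 1}; v \<in> {x..x + 1}\<rbrakk> \<Longrightarrow>
      \<bar>f u - f v\<bar> \<le> 1 / (real (Suc n))\<^sup>2"
    by metis
  \<comment> \<open>Partial sums of positive terms are strictly increasing and at least as large as
    each \<open>N n\<close>.\<close>
  define a where "a n = (\<Sum>i\<le>n. Suc (N i))" for n
  have a_step: "a n < a (Suc n)" for n by (simp add: a_def)
  have a_pos: "1 \<le> a n" for n by (cases n) (simp_all add: a_def)
  have a: "inc_seq a" using a_step a_pos by (simp add: inc_seq_def)
  have a_mono: "m \<le> n \<Longrightarrow> a m \<le> a n" for m n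
    using a_step by (simp add: lift_Suc_mono_le less_imp_le)
  have N_le: "N n \<le> a n" for n
    by (cases n) (simp_all add: a_def)
  have osc: "\<bar>f v - f u\<bar> \<le> 1 / (real n)\<^sup>2"
    if "1 \<le> n" "real (a n) \<le> u" "u \<le> v" "v \<le> u + 1" for n u v
  proof -
    \<comment> \<open>\<open>N\<close> is indexed from 0, so the bound with denominator
      \<open>n\<close> squared belongs to \<open>N (n - 1)\<close>.\<close>
    have "N (n - 1) \<le> a n" using N_le[of "n - 1"] a_mono[of "n - 1" n] by simp
    then have "real (N (n - 1)) \<le> u" using that by linarith
    then have "\<bar>f v - f u\<bar> \<le> 1 / (real (Suc (n - 1)))\<^sup>2"
      using that by (intro N) auto
    then show ?thesis using that by simp
  qed
  have "\<exists>K. \<forall>x\<ge>0. t * \<bar>f x\<bar> \<le> K + eta a x" if t: "0 \<le> t" for t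
  proof -
    obtain n0 where "max t 1 < real n0" using reals_Archimedean2 by blast
    then have n0: "1 \<le> n0" "t \<le> real n0" by auto
    obtain K0 where K0: "0 \<le> K0" "\<And>x. x \<in> {0..real (a n0)} \<Longrightarrow> \<bar>f x\<bar> \<le> K0"
      using SO_bounded_initial[OF f, of "real (a n0)"] by blast
    have eta_pos: "0 \<le> eta a x" if "0 \<le> x" for x using eta_ge_1[OF a that] by simp
    \<comment> \<open>Integers come first: the breakpoints are integers, so each step from
      \<open>m\<close> to \<open>Suc m\<close> stays within one linear piece of
      \<open>eta a\<close>.\<close>
    have nat_bound: "t * \<bar>f (real m)\<bar> \<le> t * K0 + eta a (real m)" if "a n0 \<le> m" for m
      using that
    proof (induction m rule: dec_induct)
      case base
      have "t * \<bar>f (real (a n0))\<bar> \<le> t * K0" using K0 t by (intro mult_left_mono) auto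
      then show ?case using eta_pos[of "real (a n0)"] by simp
    next
      case (step m)
      \<comment> \<open>The index of the piece containing \<open>m\<close> and \<open>Suc m\<close>;
        the greatest value exists because \<open>k \<le> a k\<close> for
        \<open>k \<ge> 1\<close>.\<close>
      define n where "n = (GREATEST n. a n \<le> m)"
      have bnd: "\<forall>k. a k \<le> m \<longrightarrow> k \<le> m"
      proof (intro allI impI)
        fix k assume "a k \<le> m"
        then show "k \<le> m" using inc_seq_ge[OF a, of k] by (cases "k = 0") auto
      qed
      have n1: "a n \<le> m" unfolding n_def by (rule GreatestI_nat[where P = "\<lambda>n. a n \<le> m", OF step.hyps(1)]) (use bnd in auto)
      have n2: "n0 \<le> n" unfolding n_def by (rule Greatest_le_nat[where P = "\<lambda>n. a n \<le> m", OF step.hyps(1)]) (use bnd in auto)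
      have "\<not> a (Suc n) \<le> m"
      proof
        assume "a (Suc n) \<le> m"
        then have "Suc n \<le> n" unfolding n_def by (rule Greatest_le_nat[where P = "\<lambda>n. a n \<le> m"]) (use bnd in auto)
        then show False by simp
      qed
      then have n3: "real (Suc m) \<le> real (a (Suc n))" by simp
      have n: "1 \<le> n" using n0 n2 by simp
      have "eta a (real (Suc m)) - eta a (real m) = (real (Suc m) - real m) / real n"
        using n1 n3 n by (intro eta_increment[OF a]) auto
      \<comment> \<open>Since \<open>t \<le> n0 \<le> n\<close>, the change of
        \<open>t * \<bar>f\<bar>\<close> is at most \<open>1/n\<close>, precisely the increment of
        \<open>eta a\<close>.\<close>
      moreover have "t * \<bar>f (real (Suc m)) - f (real m)\<bar> \<le> real n * (1 / (real n)\<^sup>2)"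
        using n n0 n1 n2 t by (intro mult_mono osc) auto
      moreover have "t * \<bar>f (real (Suc m))\<bar> \<le> t * \<bar>f (real m)\<bar> + t * \<bar>f (real (Suc m)) - f (real m)\<bar>"
        unfolding distrib_left[symmetric] using t by (intro mult_left_mono) auto
      moreover have "real n * (1 / (real n)\<^sup>2) = 1 / real n" by (simp add: power2_eq_square)
      ultimately show ?case using step.IH by simp
    qed
    have "t * \<bar>f x\<bar> \<le> t * K0 + t + eta a x" if x: "0 \<le> x" for x
    proof (cases "x \<le> real (a n0)")
      case True
      then have "t * \<bar>f x\<bar> \<le> t * K0" using K0 t x by (intro mult_left_mono) auto
      then show ?thesis using eta_pos[OF x] t by linarith
    next
      case False
      define m where "m = nat \<lfloor>x\<rfloor>"
      have m: "real m \<le> x" "x \<le> real m + 1" "a n0 \<le> m"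
        using False x unfolding m_def by linarith+
      \<comment> \<open>From the integer \<open>m\<close> below \<open>x\<close> to \<open>x\<close>
        itself, \<open>f\<close> moves by at most 1, which costs the extra summand \<open>t\<close>;
        \<open>eta a\<close> does not decrease.\<close>
      have "1 / (real n0)\<^sup>2 \<le> 1" using n0(1) by (simp add: divide_le_eq)
      then have "\<bar>f x - f (real m)\<bar> \<le> 1"
        using osc[of n0 "real m" x] m n0 by linarith
      then have "t * \<bar>f x\<bar> \<le> t * (\<bar>f (real m)\<bar> + 1)" using t by (intro mult_left_mono) auto
      then show ?thesis
        using nat_bound[OF m(3)] eta_mono[OF a m(1)] by (simp add: distrib_left)
    qed
    then show ?thesis by blast
  qed
  with a show thesis by (rule that)
qed

section \<open>Homomorphisms: positivity and representation by a point\<close>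

text \<open>Extensionality turns \<open>f \<le> g\<close> on the half-line into the equality
  \<open>SO_sup f g = g\<close>, so \<open>\<phi> g\<close> is the maximum of
  \<open>\<phi> f\<close> and \<open>\<phi> g\<close>.\<close>

lemma SO_hom_mono:
  assumes \<phi>: "\<phi> \<in> SO_homs" and fg: "f \<in> SO" "g \<in> SO" and le: "\<And>x. 0 \<le> x \<Longrightarrow> f x \<le> g x"
  shows "\<phi> f \<le> \<phi> g"
proof -
  have "SO_sup f g = restrict g {0..}"
    unfolding SO_sup_def using le by (intro restrict_ext) auto
  also have "\<dots> = g" using fg(2) by (simp add: SO_def extensional_restrict)
  finally show ?thesis using \<phi> fg unfolding SO_homs_def by (metis (mono_tags, lifting) max.cobounded1 mem_Collect_eq)
qed

lemma SO_hom_add: "\<lbrakk>\<phi> \<in> SO_homs; f \<in> SO; g \<in> SO\<rbrakk> \<Longrightarrow> \<phi> (SO_add f g) = \<phi> f + \<phi> g"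
  and SO_hom_scale: "\<lbrakk>\<phi> \<in> SO_homs; f \<in> SO\<rbrakk> \<Longrightarrow> \<phi> (SO_scale c f) = c * \<phi> f"
  and SO_hom_sup: "\<lbrakk>\<phi> \<in> SO_homs; f \<in> SO; g \<in> SO\<rbrakk> \<Longrightarrow> \<phi> (SO_sup f g) = max (\<phi> f) (\<phi> g)"
  by (auto simp: SO_homs_def)

lemma SO_hom_nonneg:
  assumes \<phi>: "\<phi> \<in> SO_homs" and f: "f \<in> SO" and "\<And>x. 0 \<le> x \<Longrightarrow> 0 \<le> f x"
  shows "0 \<le> \<phi> f"
proof -
  have "\<phi> (SO_scale 0 f) \<le> \<phi> f"
    using assms by (intro SO_hom_mono[OF \<phi>] SO_scale_closed) (auto simp: SO_scale_def)
  then show ?thesis by (simp add: SO_hom_scale[OF \<phi> f])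
qed

text \<open>Written with lattice and linear operations so that homomorphisms commute with
  it.\<close>

definition SO_abs :: "(real \<Rightarrow> real) \<Rightarrow> real \<Rightarrow> real" where
  "SO_abs f = SO_sup f (SO_scale (- 1) f)"

lemma SO_abs_apply: "0 \<le> x \<Longrightarrow> SO_abs f x = \<bar>f x\<bar>"
  by (auto simp: SO_abs_def SO_sup_def SO_scale_def)

lemma SO_abs_closed: "f \<in> SO \<Longrightarrow> SO_abs f \<in> SO"
  by (simp add: SO_abs_def SO_sup_closed SO_scale_closed)

lemma SO_hom_abs: "\<phi> \<in> SO_homs \<Longrightarrow> f \<in> SO \<Longrightarrow> \<phi> (SO_abs f) = \<bar>\<phi> f\<bar>"
  by (simp add: SO_abs_def SO_hom_sup SO_hom_scale SO_scale_closed max_def)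

text \<open>Adding \<open>ln (1 + x)\<close> to \<open>\<bar>f\<bar>\<close> makes it unbounded, which absorbs the additive constants
  in the domination by \<open>eta a\<close>.\<close>

lemma SO_hom_nonzero_compact:
  assumes \<phi>: "\<phi> \<in> SO_homs" and f: "f \<in> SO" "\<phi> f \<noteq> 0"
  obtains k B where "k \<in> SO" "0 < \<phi> k" "\<And>x. 0 \<le> x \<Longrightarrow> B < x \<Longrightarrow> k x \<le> 0"
proof -
  define g where "g = SO_add (SO_abs f) SO_ln"
  have g: "g \<in> SO" unfolding g_def by (intro SO_add_closed SO_abs_closed f SO_ln_closed)
  have "0 \<le> \<phi> SO_ln"
    by (rule SO_hom_nonneg[OF \<phi> SO_ln_closed]) (simp add: SO_ln_def)
  then have pos: "0 < \<phi> g"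
    unfolding g_def using f by (simp add: SO_hom_add[OF \<phi>] SO_abs_closed SO_ln_closed SO_hom_abs[OF \<phi>])
  have g_ge: "ln (1 + x) \<le> g x" if "0 \<le> x" for x
    using that by (simp add: g_def SO_add_def SO_abs_apply SO_ln_def)
  obtain a where a: "inc_seq a" and dom: "\<And>t. 0 \<le> t \<Longrightarrow> \<exists>K. \<forall>x\<ge>0. t * \<bar>g x\<bar> \<le> K + eta a x"
    using SO_dominated_by_eta[OF g] by blast
  \<comment> \<open>Large enough that \<open>t * g\<close> outweighs \<open>eta a\<close> under
    \<open>\<phi>\<close>, which makes \<open>\<phi> k\<close> positive below.\<close>
  obtain t where t: "max 0 (\<phi> (SO_eta a) / \<phi> g) < t" using gt_ex by blast
  then have t_pos: "0 \<le> t + 1" and "\<phi> (SO_eta a) < t * \<phi> g"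
    using pos by (auto simp: field_simps)
  \<comment> \<open>Domination is applied with \<open>t + 1\<close>: the spare copy of
    \<open>g\<close> exceeds \<open>K\<close> beyond \<open>exp K\<close> and cancels it, leaving
    \<open>t * g x \<le> eta a x\<close>.\<close>
  obtain K where K: "\<And>x. 0 \<le> x \<Longrightarrow> (t + 1) * \<bar>g x\<bar> \<le> K + eta a x" using dom[OF t_pos] by blast
  define k where "k = SO_add (SO_scale t g) (SO_scale (- 1) (SO_eta a))"
  show thesis
  proof (rule that)
    show "k \<in> SO"
      unfolding k_def by (intro SO_add_closed SO_scale_closed g SO_eta_closed a)
    show "0 < \<phi> k"
      unfolding k_def using \<open>\<phi> (SO_eta a) < t * \<phi> g\<close>
      by (simp add: SO_hom_add[OF \<phi>] SO_hom_scale[OF \<phi>] SO_scale_closed g SO_eta_closed a)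
    fix x :: real assume x: "0 \<le> x" "exp K < x"
    have "K \<le> ln (1 + x)" using x by (simp add: ln_ge_iff)
    moreover have "0 \<le> ln (1 + x)" using x by simp
    ultimately have "K \<le> g x" "0 \<le> g x" using g_ge[OF x(1)] by linarith+
    then have "t * g x \<le> eta a x" using K[OF x(1)] by (simp add: distrib_right)
    then show "k x \<le> 0"
      using x by (simp add: k_def SO_add_def SO_scale_def SO_eta_def)
  qed
qed

text \<open>By linearity, iterating \<open>SO_add\<close> from the zero function stays in the
  kernel. This merges the kernel elements belonging to a finite subcover.\<close>

lemma SO_hom_kernel_sum:
  assumes \<phi>: "\<phi> \<in> SO_homs" and "finite D"
    and "\<And>x. x \<in> D \<Longrightarrow> g x \<in> SO" "\<And>x. x \<in> D \<Longrightarrow> \<phi> (g x) = 0"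
  shows "\<exists>G\<in>SO. \<phi> G = 0 \<and> (\<forall>z\<ge>0. G z = (\<Sum>x\<in>D. g x z))"
  using assms(2-)
proof (induction D)
  case empty
  show ?case
    by (rule bexI[of _ "SO_scale 0 SO_one"])
      (simp_all add: SO_hom_scale[OF \<phi>] SO_one_closed SO_scale_closed, simp add: SO_scale_def)
next
  case (insert x D)
  then obtain G where "G \<in> SO" "\<phi> G = 0" "\<forall>z\<ge>0. G z = (\<Sum>x\<in>D. g x z)" by auto
  then show ?case using insert
    by (intro bexI[of _ "SO_add (g x) G"])
      (auto simp: SO_hom_add[OF \<phi>] SO_add_closed, simp add: SO_add_def)
qed

text \<open>Otherwise each point of \<open>{0..B}\<close> has a kernel element nonzero there. A
  finite sum \<open>G\<close> of their absolute values is a kernel element positive on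
  \<open>{0..B}\<close>; a multiple of \<open>G\<close> dominates \<open>k\<close>, forcing
  \<open>\<phi> k \<le> 0\<close>.\<close>

lemma SO_hom_kernel_point:
  assumes \<phi>: "\<phi> \<in> SO_homs" and k: "k \<in> SO" "0 < \<phi> k" "\<And>x. 0 \<le> x \<Longrightarrow> B < x \<Longrightarrow> k x \<le> 0"
  shows "\<exists>x\<ge>0. \<forall>g\<in>SO. \<phi> g = 0 \<longrightarrow> g x = 0"
proof (rule ccontr)
  assume "\<not> ?thesis"
  then have "\<forall>x\<in>{0..B}. \<exists>g. g \<in> SO \<and> \<phi> g = 0 \<and> g x \<noteq> 0" by auto
  then obtain g0 where "\<forall>x\<in>{0..B}. g0 x \<in> SO \<and> \<phi> (g0 x) = 0 \<and> g0 x x \<noteq> 0" by (metis (no_types))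
  then have g0: "\<And>x. x \<in> {0..B} \<Longrightarrow> g0 x \<in> SO" "\<And>x. x \<in> {0..B} \<Longrightarrow> \<phi> (g0 x) = 0"
    "\<And>x. x \<in> {0..B} \<Longrightarrow> g0 x x \<noteq> 0" by auto
  \<comment> \<open>Absolute values stay in the kernel and cannot cancel when summed.\<close>
  define g where "g x = SO_abs (g0 x)" for x
  have gSO: "g x \<in> SO" and g\<phi>: "\<phi> (g x) = 0" if "x \<in> {0..B}" for x
    using g0[OF that] by (simp_all add: g_def SO_abs_closed SO_hom_abs[OF \<phi>])
  have g_nonneg: "0 \<le> g x z" if "0 \<le> z" for x z using that by (simp add: g_def SO_abs_apply)
  have g_pos: "0 < g x x" if "x \<in> {0..B}" for x using g0(3)[OF that] that by (simp add: g_def SO_abs_apply)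
  \<comment> \<open>Positivity of \<open>g x\<close> is open only relative to the half-line; the
    covering argument uses open sets of the whole line.\<close>
  have "\<exists>W. open W \<and> W \<inter> {0..} = {z \<in> {0..}. 0 < g x z}" if "x \<in> {0..B}" for x
  proof -
    have "openin (top_of_set {0..}) ({0..} \<inter> g x -` {0<..})"
      using continuous_openin_preimage_gen[OF SO_continuous[OF gSO[OF that]] open_greaterThan] .
    then obtain W where "open W" "{0..} \<inter> g x -` {0<..} = {0..} \<inter> W" by (auto simp: openin_open)
    then show ?thesis by (intro exI[of _ W]) auto
  qed
  then obtain W where W: "\<And>x. x \<in> {0..B} \<Longrightarrow> open (W x)"
    "\<And>x. x \<in> {0..B} \<Longrightarrow> W x \<inter> {0..} = {z \<in> {0..}. 0 < g x z}" by metis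
  have "compact {0..B}" by simp
  then obtain D where D: "D \<subseteq> {0..B}" "finite D" "{0..B} \<subseteq> (\<Union>x\<in>D. W x)"
  proof (rule compactE_image)
    show "open (W x)" if "x \<in> {0..B}" for x using W(1) that .
    show "{0..B} \<subseteq> (\<Union>x\<in>{0..B}. W x)"
    proof
      fix x assume x: "x \<in> {0..B}"
      then have "x \<in> W x" using W(2)[OF x] g_pos[OF x] by auto
      with x show "x \<in> (\<Union>x\<in>{0..B}. W x)" by blast
    qed
  qed
  have "\<exists>G\<in>SO. \<phi> G = 0 \<and> (\<forall>z\<ge>0. G z = (\<Sum>x\<in>D. g x z))"
    using SO_hom_kernel_sum[OF \<phi> D(2), of g] D(1) gSO g\<phi> by blast
  then obtain G where G: "G \<in> SO" "\<phi> G = 0" "\<And>z. 0 \<le> z \<Longrightarrow> G z = (\<Sum>x\<in>D. g x z)" by blast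
  have G_nonneg: "0 \<le> G z" if "0 \<le> z" for z using G(3)[OF that] g_nonneg[OF that] by (simp add: sum_nonneg)
  have G_pos: "0 < G z" if z: "z \<in> {0..B}" for z
  proof -
    obtain x where x: "x \<in> D" "z \<in> W x" using D(3) z by blast
    have "x \<in> {0..B}" using x(1) D(1) by blast
    then have "0 < g x z" using W(2)[of x] x(2) z by auto
    then have "0 < (\<Sum>x\<in>D. g x z)" using x D(2) g_nonneg z by (intro sum_pos2[of D x]) auto
    then show ?thesis using G(3) z by simp
  qed
  have "\<exists>C. \<forall>z\<in>{0..B}. k z / G z \<le> C"
  proof -
    have "continuous_on {0..B} (\<lambda>z. k z / G z)"
      using G_pos by (intro continuous_on_divide continuous_on_subset[OF SO_continuous[OF k(1)]]
        continuous_on_subset[OF SO_continuous[OF G(1)]]) fastforce+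
    then have "bounded ((\<lambda>z. k z / G z) ` {0..B})"
      by (intro compact_imp_bounded compact_continuous_image) auto
    then obtain C where "\<forall>y\<in>(\<lambda>z. k z / G z) ` {0..B}. norm y \<le> C" by (auto simp: bounded_iff)
    then have "norm (k z / G z) \<le> C" if "z \<in> {0..B}" for z using that by blast
    then have "k z / G z \<le> C" if "z \<in> {0..B}" for z
      using that abs_ge_self[of "k z / G z"] unfolding real_norm_def by (meson order_trans)
    then show ?thesis by blast
  qed
  then obtain C where C: "\<And>z. z \<in> {0..B} \<Longrightarrow> k z / G z \<le> C" by blast
  \<comment> \<open>The factor must be nonnegative so that the multiple of \<open>G\<close> also
    dominates beyond \<open>B\<close>, where \<open>k \<le> 0 \<le> G\<close>.\<close>
  have "k z \<le> SO_scale (max 0 C) G z" if "0 \<le> z" for z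
  proof (cases "z \<le> B")
    case True
    then have z: "z \<in> {0..B}" using that by simp
    have "k z \<le> C * G z" using C[OF z] G_pos[OF z] by (simp add: pos_divide_le_eq)
    also have "\<dots> \<le> max 0 C * G z" using G_nonneg[OF that] by (intro mult_right_mono) auto
    finally show ?thesis using that by (simp add: SO_scale_def)
  next
    case False
    then have "k z \<le> 0" using k(3) that by simp
    also have "0 \<le> max 0 C * G z" using G_nonneg[OF that] by simp
    finally show ?thesis using that by (simp add: SO_scale_def)
  qed
  then have "\<phi> k \<le> \<phi> (SO_scale (max 0 C) G)"
    by (intro SO_hom_mono[OF \<phi>] k SO_scale_closed G)
  then show False using k(2) G by (simp add: SO_hom_scale[OF \<phi>])
qed

lemma SO_hom_representation:
  assumes \<phi>: "\<phi> \<in> SO_homs" and f: "f \<in> SO" "\<phi> f \<noteq> 0"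
  obtains x y where "0 \<le> x" "0 < y" "\<And>g. g \<in> SO \<Longrightarrow> \<phi> g = y * g x"
proof -
  obtain k B where "k \<in> SO" "0 < \<phi> k" "\<And>x. 0 \<le> x \<Longrightarrow> B < x \<Longrightarrow> k x \<le> 0"
    using SO_hom_nonzero_compact[OF assms] by blast
  from SO_hom_kernel_point[OF \<phi> this] obtain x
    where x: "0 \<le> x" and ker: "\<And>g. g \<in> SO \<Longrightarrow> \<phi> g = 0 \<Longrightarrow> g x = 0" by blast
  have "\<phi> SO_one \<noteq> 0" using ker[OF SO_one_closed] x by (auto simp: SO_one_def)
  moreover have "0 \<le> \<phi> SO_one"
    by (rule SO_hom_nonneg[OF \<phi> SO_one_closed]) (simp add: SO_one_def)
  ultimately have pos: "0 < \<phi> SO_one" by simp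
  have "\<phi> g = \<phi> SO_one * g x" if g: "g \<in> SO" for g
  proof -
    \<comment> \<open>The multiple of \<open>SO_one\<close> is chosen to put \<open>?h\<close> into
      the kernel; its vanishing at \<open>x\<close> is then the claimed formula.\<close>
    let ?h = "SO_add g (SO_scale (- (\<phi> g / \<phi> SO_one)) SO_one)"
    have "?h \<in> SO" by (intro SO_add_closed SO_scale_closed g SO_one_closed)
    moreover have "\<phi> ?h = 0"
      using pos by (simp add: SO_hom_add[OF \<phi>] SO_hom_scale[OF \<phi>] SO_scale_closed g SO_one_closed)
    ultimately have "?h x = 0" by (rule ker)
    then show ?thesis using x pos by (simp add: SO_add_def SO_scale_def SO_one_def field_simps)
  qed
  with x pos show thesis by (rule that)
qed

section \<open>The evaluation map and its bijectivity\<close>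

definition model_eval :: "(real \<times> real) option \<Rightarrow> (real \<Rightarrow> real) \<Rightarrow> real" where
  "model_eval p = (\<lambda>f\<in>SO. case p of None \<Rightarrow> 0 | Some (x, y) \<Rightarrow> y * f x)"

lemma model_eval_None: "f \<in> SO \<Longrightarrow> model_eval None f = 0"
  and model_eval_Some: "f \<in> SO \<Longrightarrow> model_eval (Some (x, y)) f = y * f x"
  by (simp_all add: model_eval_def)

lemma model_carrier_cases:
  assumes "p \<in> model_carrier"
  obtains "p = None" | x y where "p = Some (x, y)" "0 \<le> x" "0 < y"
  using assms by (auto simp: model_carrier_def quarter_plane_def)

lemma model_eval_in_SO_homs:
  assumes "p \<in> model_carrier"
  shows "model_eval p \<in> SO_homs"
proof -
  have ext: "model_eval p \<in> extensional SO" by (simp add: model_eval_def)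
  show ?thesis
    using assms
  proof (cases rule: model_carrier_cases)
    case 1
    then show ?thesis using ext
      by (simp add: SO_homs_def model_eval_None SO_add_closed SO_scale_closed SO_sup_closed SO_inf_closed)
  next
    case (2 x y)
    have ev: "model_eval p f = y * f x" if "f \<in> SO" for f
      using that 2(1) by (simp add: model_eval_Some)
    have "SO_add f g x = f x + g x" "SO_scale c f x = c * f x"
      "SO_sup f g x = max (f x) (g x)" "SO_inf f g x = min (f x) (g x)" for f g c
      using 2(2) by (simp_all add: SO_add_def SO_scale_def SO_sup_def SO_inf_def)
    \<comment> \<open>Multiplication by \<open>y\<close> distributes over \<open>max\<close> and
      \<open>min\<close> because \<open>y > 0\<close>.\<close>
    then show ?thesis
      unfolding SO_homs_def using ext 2(3)
      by (simp add: ev SO_add_closed SO_scale_closed SO_sup_closed SO_inf_closed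
          distrib_left max_mult_distrib_left min_mult_distrib_left)
  qed
qed

text \<open>The value at \<open>SO_one\<close> is \<open>y\<close>, or 0 at \<open>None\<close>.
  Once \<open>y > 0\<close> is known, the value at the injective \<open>SO_ln\<close> determines
  \<open>x\<close>.\<close>

lemma inj_model_eval: "inj_on model_eval model_carrier"
proof (rule inj_onI)
  fix p q assume p: "p \<in> model_carrier" and q: "q \<in> model_carrier" and eq: "model_eval p = model_eval q"
  have 1: "model_eval p SO_one = model_eval q SO_one" and l: "model_eval p SO_ln = model_eval q SO_ln"
    using eq by simp_all
  show "p = q"
    using p
  proof (cases rule: model_carrier_cases)
    case p: 1
    from q show ?thesis
    proof (cases rule: model_carrier_cases)
      case (2 x y)
      then show ?thesis using p 1
        by (simp add: model_eval_None model_eval_Some SO_one_closed) (simp add: SO_one_def)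
    qed (simp add: p)
  next
    case p: (2 x y)
    from q show ?thesis
    proof (cases rule: model_carrier_cases)
      case 1
      then show ?thesis using p \<open>model_eval p SO_one = _\<close>
        by (simp add: model_eval_None model_eval_Some SO_one_closed) (simp add: SO_one_def)
    next
      case q: (2 x' y')
      have "y = y'" using p q 1 by (simp add: model_eval_Some SO_one_closed) (simp add: SO_one_def)
      moreover have "x = x'" using p q l \<open>y = y'\<close>
        by (simp add: model_eval_Some SO_ln_closed) (simp add: SO_ln_def)
      ultimately show ?thesis using p q by simp
    qed
  qed
qed

lemma model_eval_image: "model_eval ` model_carrier = SO_homs"
proof
  show "model_eval ` model_carrier \<subseteq> SO_homs" using model_eval_in_SO_homs by blast
  show "SO_homs \<subseteq> model_eval ` model_carrier"
  proof
    fix \<phi> assume \<phi>: "\<phi> \<in> SO_homs"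
    then have ext: "\<phi> \<in> extensional SO" by (simp add: SO_homs_def)
    show "\<phi> \<in> model_eval ` model_carrier"
    proof (cases "\<exists>f\<in>SO. \<phi> f \<noteq> 0")
      case True
      then obtain x y where xy: "0 \<le> x" "0 < y" "\<And>g. g \<in> SO \<Longrightarrow> \<phi> g = y * g x"
        using SO_hom_representation[OF \<phi>] by metis
      then have "\<phi> = model_eval (Some (x, y))"
        by (intro extensionalityI[OF ext]) (auto simp: model_eval_def)
      moreover have "Some (x, y) \<in> model_carrier"
        using xy by (simp add: model_carrier_def quarter_plane_def)
      ultimately show ?thesis by blast
    next
      case False
      then have "\<phi> = model_eval None"
        by (intro extensionalityI[OF ext]) (auto simp: model_eval_def)
      then show ?thesis by (simp add: model_carrier_def)
    qed
  qed
qed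

section \<open>Comparison of the two topologies\<close>

lemma topspace_H_SO: "topspace H_SO = SO_homs"
  by (auto simp: H_SO_def SO_homs_def PiE_def)

lemma continuous_map_eval_model:
  assumes f: "f \<in> SO"
  shows "continuous_map model_space euclideanreal (\<lambda>p. model_eval p f)"
proof -
  have "model_open {p \<in> model_carrier. model_eval p f \<in> U}" if U: "open U" for U
    unfolding model_open_def
  proof (intro conjI impI)
    have "continuous_on quarter_plane (\<lambda>q. snd q * f (fst q))"
      by (intro continuous_intros continuous_on_compose2[OF SO_continuous[OF f]])
        (auto simp: quarter_plane_def)
    then have "openin (top_of_set quarter_plane) (quarter_plane \<inter> (\<lambda>q. snd q * f (fst q)) -` U)"
      using U by (rule continuous_openin_preimage_gen)
    also have "quarter_plane \<inter> (\<lambda>q. snd q * f (fst q)) -` U =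
        Some -` {p \<in> model_carrier. model_eval p f \<in> U}"
      by (auto simp: model_carrier_def model_eval_Some[OF f])
    finally show "openin (top_of_set quarter_plane) \<dots>" .
  next
    assume "None \<in> {p \<in> model_carrier. model_eval p f \<in> U}"
    then have "0 \<in> U" by (simp add: model_eval_None[OF f])
    then obtain e where e: "0 < e" "\<And>z. \<bar>z\<bar> < e \<Longrightarrow> z \<in> U"
      using U by (auto simp: open_dist dist_real_def)
    obtain a where a: "inc_seq a" and "\<exists>K. \<forall>x\<ge>0. 1 * \<bar>f x\<bar> \<le> K + eta a x"
      using SO_dominated_by_eta[OF f] zero_le_one by metis
    then obtain K where K: "\<And>x. 0 \<le> x \<Longrightarrow> \<bar>f x\<bar> \<le> K + eta a x" by auto
    \<comment> \<open>As \<open>eta a \<ge> 1\<close>, \<open>K + eta a\<close> is at most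
      \<open>(\<bar>K\<bar> + 1) * eta a\<close>; one more copy of \<open>eta a\<close> makes the
      bound on \<open>\<bar>f\<bar>\<close> strict.\<close>
    define C where "C = \<bar>K\<bar> + 2"
    have C: "0 < C" by (simp add: C_def)
    have "y * f x \<in> U" if x: "0 \<le> x" and y: "0 < y" "y \<le> e / C * inverse (eta a x)" for x y
    proof (rule e(2))
      have h: "1 \<le> eta a x" using eta_ge_1[OF a x] .
      have "\<bar>K\<bar> * 1 \<le> \<bar>K\<bar> * eta a x" using h by (intro mult_left_mono) auto
      then have "\<bar>f x\<bar> < C * eta a x"
        using K[OF x] h unfolding C_def distrib_right by linarith
      then have "y * \<bar>f x\<bar> < y * (C * eta a x)" using y by simp
      also have "\<dots> \<le> e / C * inverse (eta a x) * (C * eta a x)"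
        using y C h by (intro mult_right_mono) auto
      also have "\<dots> = e" using C h by simp
      finally show "\<bar>y * f x\<bar> < e" using y by (simp add: abs_mult)
    qed
    then have "zero_nhd (e / C) a \<subseteq> {p \<in> model_carrier. model_eval p f \<in> U}"
      using \<open>0 \<in> U\<close> by (auto simp: zero_nhd_def model_carrier_def quarter_plane_def
          model_eval_None[OF f] model_eval_Some[OF f])
    then show "\<exists>\<epsilon>>0. \<exists>a. inc_seq a \<and> zero_nhd \<epsilon> a \<subseteq> {p \<in> model_carrier. model_eval p f \<in> U}"
      using a e C by (intro exI[of _ "e / C"]) auto
  qed auto
  then show ?thesis
    by (simp add: continuous_map_def topspace_model_space openin_model_space)
qed

lemma continuous_map_model_eval: "continuous_map model_space H_SO model_eval"
proof -
  have "model_eval ` topspace model_space \<subseteq> extensional SO"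
    by (auto simp: model_eval_def)
  then show ?thesis
    unfolding H_SO_def continuous_map_in_subtopology continuous_map_componentwise
    using continuous_map_eval_model model_eval_image by (auto simp: topspace_model_space)
qed

lemma openin_H_SO_eval:
  assumes f: "f \<in> SO" and U: "open U"
  shows "openin H_SO {\<phi> \<in> SO_homs. \<phi> f \<in> U}"
proof -
  have "continuous_map H_SO euclideanreal (\<lambda>\<phi>. \<phi> f)"
    unfolding H_SO_def
    by (intro continuous_map_from_subtopology continuous_map_product_projection f)
  then show ?thesis using U openin_continuous_map_preimage[of H_SO euclideanreal "\<lambda>\<phi>. \<phi> f" U]
    by (simp add: topspace_H_SO)
qed

lemma open_map_model_eval: "open_map model_space H_SO model_eval"
  unfolding open_map_def
proof (intro allI impI)
  fix U assume "openin model_space U"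
  then have U: "U \<subseteq> model_carrier" "openin (top_of_set quarter_plane) (Some -` U)"
    "None \<in> U \<Longrightarrow> \<exists>\<epsilon>>0. \<exists>a. inc_seq a \<and> zero_nhd \<epsilon> a \<subseteq> U"
    by (auto simp: openin_model_space model_open_def)
  have "\<exists>T. openin H_SO T \<and> model_eval p \<in> T \<and> T \<subseteq> model_eval ` U" if p: "p \<in> U" for p
  proof -
    have "p \<in> model_carrier" using p U(1) by blast
    then show ?thesis
    proof (cases rule: model_carrier_cases)
      case 1
      then obtain \<epsilon> a where \<epsilon>: "\<epsilon> > 0" "inc_seq a" "zero_nhd \<epsilon> a \<subseteq> U" using U(3) p by blast
      have eta: "SO_eta a \<in> SO" by (rule SO_eta_closed[OF \<epsilon>(2)])
      \<comment> \<open>For \<open>q = Some (x, y)\<close> the condition reads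
        \<open>y * eta a x < \<epsilon>\<close>, which puts \<open>q\<close> into
        \<open>zero_nhd \<epsilon> a\<close>.\<close>
      let ?T = "{\<phi> \<in> SO_homs. \<phi> (SO_eta a) \<in> {..<\<epsilon>}}"
      have "?T \<subseteq> model_eval ` U"
      proof
        fix \<phi> assume \<phi>: "\<phi> \<in> ?T"
        then obtain q where q: "q \<in> model_carrier" "\<phi> = model_eval q"
          using model_eval_image by blast
        have "q \<in> zero_nhd \<epsilon> a"
          using q(1)
        proof (cases rule: model_carrier_cases)
          case (2 x y)
          have "1 \<le> eta a x" using eta_ge_1[OF \<epsilon>(2) 2(2)] .
          moreover have "y * eta a x < \<epsilon>"
            using \<phi> q 2 by (simp add: model_eval_Some[OF eta]) (simp add: SO_eta_def)
          ultimately have "y \<le> \<epsilon> * inverse (eta a x)" by (simp add: field_simps)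
          then show ?thesis using 2 by (simp add: zero_nhd_def quarter_plane_def)
        qed (simp add: zero_nhd_def)
        then show "\<phi> \<in> model_eval ` U" using q \<epsilon> by blast
      qed
      moreover have "openin H_SO ?T" by (rule openin_H_SO_eval[OF eta]) simp
      moreover have "model_eval p \<in> ?T"
        using 1 \<epsilon> model_eval_in_SO_homs[OF \<open>p \<in> model_carrier\<close>] by (simp add: model_eval_None[OF eta])
      ultimately show ?thesis by blast
    next
      case (2 x0 y0)
      then have "(x0, y0) \<in> Some -` U" using p by simp
      then obtain e where e: "0 < e"
        "\<And>q. q \<in> quarter_plane \<Longrightarrow> dist q (x0, y0) < e \<Longrightarrow> Some q \<in> U"
        using U(2) unfolding openin_euclidean_subtopology_iff by blast
      let ?t = "SO_tent x0 (e / 2)"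
      \<comment> \<open>A positive value at the tent excludes \<open>None\<close> and gives
        \<open>\<bar>x - x0\<bar> < e / 2\<close>; the value at \<open>SO_one\<close> controls
        \<open>y\<close>. Together they place \<open>(x, y)\<close> within \<open>e\<close> of
        \<open>(x0, y0)\<close>.\<close>
      let ?T = "{\<phi> \<in> SO_homs. \<phi> ?t \<in> {0<..}} \<inter> {\<phi> \<in> SO_homs. \<phi> SO_one \<in> ball y0 (e / 2)}"
      have "?T \<subseteq> model_eval ` U"
      proof
        fix \<phi> assume \<phi>: "\<phi> \<in> ?T"
        then obtain q where q: "q \<in> model_carrier" "\<phi> = model_eval q"
          using model_eval_image by blast
        have "q \<in> U"
          using q(1)
        proof (cases rule: model_carrier_cases)
          case 1
          then show ?thesis using \<phi> q by (simp add: model_eval_None[OF SO_tent_closed])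
        next
          case xy: (2 x y)
          have "0 < y * ?t x" using \<phi> q xy by (simp add: model_eval_Some[OF SO_tent_closed])
          then have "0 < ?t x" using xy by (simp add: zero_less_mult_iff)
          then have "dist x x0 < e / 2"
            using xy by (simp add: SO_tent_def dist_real_def less_max_iff_disj)
          moreover have "dist y y0 < e / 2"
            using \<phi> q xy by (simp add: model_eval_Some[OF SO_one_closed])
              (simp add: SO_one_def dist_commute)
          moreover have "dist (x, y) (x0, y0) \<le> dist x x0 + dist y y0"
            unfolding dist_Pair_Pair by (rule sqrt_sum_squares_le_sum) auto
          ultimately show ?thesis using e(2)[of "(x, y)"] xy by (simp add: quarter_plane_def)
        qed
        then show "\<phi> \<in> model_eval ` U" using q by blast
      qed
      moreover have "openin H_SO ?T"
        by (intro openin_Int openin_H_SO_eval SO_tent_closed SO_one_closed) auto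
      moreover have "model_eval p \<in> ?T"
        using 2 e(1) model_eval_in_SO_homs[OF \<open>p \<in> model_carrier\<close>]
        by (simp add: model_eval_Some SO_tent_closed SO_one_closed) (simp add: SO_tent_def SO_one_def)
      ultimately show ?thesis by blast
    qed
  qed
  then show "openin H_SO (model_eval ` U)" by (subst openin_subopen) blast
qed

theorem theorem3p10:
  shows "H_SO homeomorphic_space model_space"
proof -
  have "homeomorphic_map model_space H_SO model_eval"
    using continuous_map_model_eval open_map_model_eval inj_model_eval model_eval_image
    by (intro bijective_open_imp_homeomorphic_map) (simp_all add: topspace_model_space topspace_H_SO)
  then show ?thesis
    using homeomorphic_map_imp_homeomorphic_space homeomorphic_space_sym by blast
qed

end
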